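(* Let $X$ be a completely regular Hausdorff space. (i) The intersection of all essential minimal prime ideals of $C(X)$ is equal to the socle $C_F(X)$ of $C(X)$. (ii) Every intersection of essential minimal prime ideals of $C(X)$ is an essential ideal if and only if the set of isolated points of $X$ is dense in $X$. (iii) The intersection of all essential minimal prime ideals of $C(X)$ is equal to $C_K(X)$ if and only if $I(X)=X_L=\bigcup_{f\in C_K(X)}\overline{X\setminus Z(f)}$; that is, if and only if $I(X)=X_L$ and $C_K(X)$ is a pure ideal.
   Context: $C(X)$ is the ring of real-valued continuous functions on $X$; $Z(f)=\{x\in X: f(x)=0\}$; $\overline{\,\cdot\,}$ denotes closure in $X$. $C_K(X)$ is the ideal of functions $f\in C(X)$ with compact support $\overline{X\setminus Z(f)}$. $I(X)$ is the set of isolated points of $X$, and $X_L$ is the set of points of $X$ having a compact neighborhood. The socle of a commutative ring is the sum of its minimal ideals (equivalently the intersection of its essential ideals); the socle $C_F(X)$ of $C(X)$ is the set of functions in $C(X)$ that vanish everywhere except on a finite number of points of $X$. A nonzero ideal is essential if it intersects every nonzero ideal nontrivially; an essential minimal prime ideal is a minimal prime ideal which is essential. The intersection of an empty family of ideals is $C(X)$. An ideal $I$ is pure if for every $f\in I$ there is $g\in I$ with $f=fg$. *)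

theory Defs
  imports "HOL-Analysis.Analysis" "HOL-Algebra.Ideal"
begin

(* C(X). Functions live on the whole type, so they are normalised to be undefined
   outside topspace X; otherwise two elements could agree on X and still differ. *)
definition cont_ring :: "'a topology \<Rightarrow> ('a \<Rightarrow> real) ring" where
  "cont_ring X =
    \<lparr>carrier = {f. continuous_map X euclideanreal f \<and> f \<in> extensional (topspace X)},
     monoid.mult = (\<lambda>f g. \<lambda>x\<in>topspace X. f x * g x),
     one = (\<lambda>x\<in>topspace X. 1),
     zero = (\<lambda>x\<in>topspace X. 0),
     add = (\<lambda>f g. \<lambda>x\<in>topspace X. f x + g x)\<rparr>"

definition zero_set :: "'a topology \<Rightarrow> ('a \<Rightarrow> real) \<Rightarrow> 'a set" where
  "zero_set X f = {x \<in> topspace X. f x = 0}"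

definition supp :: "'a topology \<Rightarrow> ('a \<Rightarrow> real) \<Rightarrow> 'a set" where
  "supp X f = X closure_of (topspace X - zero_set X f)"

definition C_K :: "'a topology \<Rightarrow> ('a \<Rightarrow> real) set" where
  "C_K X = {f \<in> carrier (cont_ring X). compactin X (supp X f)}"

definition C_F :: "'a topology \<Rightarrow> ('a \<Rightarrow> real) set" where
  "C_F X = {f \<in> carrier (cont_ring X). finite (topspace X - zero_set X f)}"

definition isolated_points :: "'a topology \<Rightarrow> 'a set" where
  "isolated_points X = {x \<in> topspace X. openin X {x}}"

(* X_L; the condition on x is the one in locally_compact_space. *)
definition locally_compact_points :: "'a topology \<Rightarrow> 'a set" where
  "locally_compact_points X =
    {x \<in> topspace X. \<exists>U K. openin X U \<and> compactin X K \<and> x \<in> U \<and> U \<subseteq> K}"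

definition minimal_ideal :: "'a set \<Rightarrow> ('a, 'b) ring_scheme \<Rightarrow> bool" where
  "minimal_ideal I R \<longleftrightarrow> ideal I R \<and> I \<noteq> {\<zero>\<^bsub>R\<^esub>} \<and>
    (\<forall>J. ideal J R \<and> J \<subseteq> I \<longrightarrow> J = {\<zero>\<^bsub>R\<^esub>} \<or> J = I)"

definition socle :: "('a, 'b) ring_scheme \<Rightarrow> 'a set" where
  "socle R = {(\<Oplus>\<^bsub>R\<^esub>I\<in>F. a I) | F a.
    finite F \<and> (\<forall>I\<in>F. minimal_ideal I R \<and> a I \<in> I)}"

definition essential_ideal :: "'a set \<Rightarrow> ('a, 'b) ring_scheme \<Rightarrow> bool" where
  "essential_ideal E R \<longleftrightarrow> ideal E R \<and> E \<noteq> {\<zero>\<^bsub>R\<^esub>} \<and>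
    (\<forall>J. ideal J R \<and> J \<noteq> {\<zero>\<^bsub>R\<^esub>} \<longrightarrow> E \<inter> J \<noteq> {\<zero>\<^bsub>R\<^esub>})"

definition minimal_prime_ideal :: "'a set \<Rightarrow> ('a, 'b) ring_scheme \<Rightarrow> bool" where
  "minimal_prime_ideal P R \<longleftrightarrow> primeideal P R \<and>
    (\<forall>Q. primeideal Q R \<and> Q \<subseteq> P \<longrightarrow> Q = P)"

definition essential_minimal_primes :: "('a, 'b) ring_scheme \<Rightarrow> 'a set set" where
  "essential_minimal_primes R = {P. minimal_prime_ideal P R \<and> essential_ideal P R}"

(* Intersecting with the carrier makes the empty family yield the whole ring. *)
definition ideal_Inter :: "('a, 'b) ring_scheme \<Rightarrow> 'a set set \<Rightarrow> 'a set" where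
  "ideal_Inter R \<F> = carrier R \<inter> \<Inter>\<F>"

definition pure_ideal :: "'a set \<Rightarrow> ('a, 'b) ring_scheme \<Rightarrow> bool" where
  "pure_ideal I R \<longleftrightarrow> ideal I R \<and> (\<forall>f\<in>I. \<exists>g\<in>I. f = f \<otimes>\<^bsub>R\<^esub> g)"

end

theory Submission
  imports Defs
begin

text \<open>
  In any commutative ring, a prime \<open>P\<close> meeting some nonzero ideal \<open>J\<close> only in zero kills \<open>J\<close>, and
  it is then the annihilator of every nonzero \<open>j \<in> J\<close>. In \<open>C(X)\<close> an annihilator of \<open>j\<close> can be prime only
  if \<open>j\<close> is nonzero at a single point, because two such points are separated by functions with zero
  product; that point \<open>x\<close> is then isolated. So the inessential primes are exactly the ideals
  \<open>{f. f x = 0}\<close> with \<open>x\<close> isolated, and a prime is essential if and only if it contains the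
  characteristic function of every isolated point (\<open>essential_prime_iff_char_fun\<close>).

  Since \<open>C_F(X)\<close> is generated by these characteristic functions, it lies in every essential prime.
  Conversely, let \<open>f\<close> be nonzero at infinitely many points. The functions \<open>g\<close> that vanish at only
  finitely many points where \<open>f\<close> does not form a multiplicative set without zero, so
  (\<open>ex_minimal_prime_ideal_avoiding\<close>, by Zorn's lemma) some minimal prime contains none of them. It
  misses \<open>f\<close>, and it misses the function that is one everywhere except for a zero at an isolated point
  \<open>x\<close>; hence it contains the characteristic function of \<open>{x}\<close>. It is therefore essential, and \<open>f\<close> is
  not in the intersection. This shows that the intersection of the essential minimal primes is \<open>C_F(X)\<close>.

  The remaining claims are about \<open>C_F(X)\<close> alone. Minimal ideals consist of functions living at one
  isolated point, which gives the socle. An ideal that contains an essential ideal is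
  essential, so all intersections are essential as soon as the smallest one, \<open>C_F(X)\<close>, is; and \<open>C_F(X)\<close>
  meets every nonzero ideal if and only if every nonempty open set has an isolated point. Finally, a compact set of isolated
  points is finite, so \<open>C_K(X) \<subseteq> C_F(X)\<close> if and only if all the supports of functions in \<open>C_K(X)\<close> consist of
  isolated points; purity of \<open>C_K(X)\<close> places such supports inside the locally compact part.
\<close>

section \<open>The ring of continuous functions\<close>

abbreviation cozero :: "'a topology \<Rightarrow> ('a \<Rightarrow> real) \<Rightarrow> 'a set" where
  "cozero X f \<equiv> {x \<in> topspace X. f x \<noteq> 0}"

definition char_fun :: "'a topology \<Rightarrow> 'a set \<Rightarrow> 'a \<Rightarrow> real" where
  "char_fun X A = (\<lambda>x\<in>topspace X. if x \<in> A then 1 else 0)"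

lemma Diff_zero_set: "topspace X - zero_set X f = cozero X f"
  by (auto simp: zero_set_def)

lemma C_F_iff: "f \<in> C_F X \<longleftrightarrow> f \<in> carrier (cont_ring X) \<and> finite (cozero X f)"
  by (simp add: C_F_def Diff_zero_set)

lemma supp_eq: "supp X f = X closure_of (cozero X f)"
  by (simp add: supp_def Diff_zero_set)

lemma cont_ring_carrier_iff:
  "f \<in> carrier (cont_ring X) \<longleftrightarrow> continuous_map X euclideanreal f \<and> f \<in> extensional (topspace X)"
  by (simp add: cont_ring_def)

lemma cont_ring_apply:
  assumes "x \<in> topspace X"
  shows "(f \<otimes>\<^bsub>cont_ring X\<^esub> g) x = f x * g x" "(f \<oplus>\<^bsub>cont_ring X\<^esub> g) x = f x + g x"
    "\<one>\<^bsub>cont_ring X\<^esub> x = 1" "\<zero>\<^bsub>cont_ring X\<^esub> x = 0" "char_fun X A x = (if x \<in> A then 1 else 0)"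
  using assms by (simp_all add: cont_ring_def char_fun_def)

lemma cont_ring_eqI:
  assumes "f \<in> carrier (cont_ring X)" "g \<in> carrier (cont_ring X)"
    and "\<And>x. x \<in> topspace X \<Longrightarrow> f x = g x"
  shows "f = g"
  using assms by (auto simp: cont_ring_carrier_iff intro: extensionalityI)

lemma restrict_in_cont_ring:
  assumes "continuous_map X euclideanreal f"
  shows "restrict f (topspace X) \<in> carrier (cont_ring X)"
  using assms by (auto simp: cont_ring_carrier_iff intro: continuous_map_eq)

lemma cring_cont_ring: "cring (cont_ring X)"
proof -
  let ?R = "cont_ring X"
  have closed: "f \<otimes>\<^bsub>?R\<^esub> g \<in> carrier ?R" "f \<oplus>\<^bsub>?R\<^esub> g \<in> carrier ?R"
    if "f \<in> carrier ?R" "g \<in> carrier ?R" for f g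
    using that restrict_in_cont_ring[of X "\<lambda>x. f x * g x"] restrict_in_cont_ring[of X "\<lambda>x. f x + g x"]
    by (auto simp: cont_ring_carrier_iff cont_ring_def intro: continuous_map_real_mult continuous_map_add)
  have const: "\<one>\<^bsub>?R\<^esub> \<in> carrier ?R" "\<zero>\<^bsub>?R\<^esub> \<in> carrier ?R"
    using restrict_in_cont_ring[of X "\<lambda>x. 1"] restrict_in_cont_ring[of X "\<lambda>x. 0"]
    by (auto simp: cont_ring_def)
  show ?thesis
  proof (intro cringI abelian_groupI comm_monoidI)
    fix f assume f: "f \<in> carrier ?R"
    define g where "g = restrict (\<lambda>x. - f x) (topspace X)"
    have g: "g \<in> carrier ?R"
      unfolding g_def using f by (intro restrict_in_cont_ring) (auto simp: cont_ring_carrier_iff intro: continuous_map_minus)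
    have "g \<oplus>\<^bsub>?R\<^esub> f = \<zero>\<^bsub>?R\<^esub>"
      by (rule cont_ring_eqI[of _ X]) (simp_all add: f g closed const cont_ring_apply, simp add: g_def)
    with g show "\<exists>g\<in>carrier ?R. g \<oplus>\<^bsub>?R\<^esub> f = \<zero>\<^bsub>?R\<^esub>" by blast
  qed (auto intro!: cont_ring_eqI[of _ X] simp: closed const cont_ring_apply algebra_simps)
qed

lemma cont_ring_reduced:
  assumes "f \<in> carrier (cont_ring X)" "f \<otimes>\<^bsub>cont_ring X\<^esub> f = \<zero>\<^bsub>cont_ring X\<^esub>"
  shows "f = \<zero>\<^bsub>cont_ring X\<^esub>"
proof -
  interpret cring "cont_ring X" by (rule cring_cont_ring)
  have "f x = 0" if "x \<in> topspace X" for x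
    using fun_cong[OF assms(2), of x] that by (simp add: cont_ring_apply)
  then show ?thesis using assms(1) by (intro cont_ring_eqI[of _ X]) (auto simp: cont_ring_apply)
qed

lemma finsum_cont_ring_apply:
  assumes "finite F" "\<And>i. i \<in> F \<Longrightarrow> a i \<in> carrier (cont_ring X)" "x \<in> topspace X"
  shows "finsum (cont_ring X) a F x = (\<Sum>i\<in>F. a i x)"
proof -
  interpret cring "cont_ring X" by (rule cring_cont_ring)
  show ?thesis
    using assms by (induction F) (auto simp: finsum_insert cont_ring_apply Pi_def)
qed

lemma scaled_in_cont_ring:
  assumes "f \<in> carrier (cont_ring X)"
  shows "(\<lambda>x\<in>topspace X. c * f x) \<in> carrier (cont_ring X)"
  using assms by (intro restrict_in_cont_ring) (auto simp: cont_ring_carrier_iff intro: continuous_map_real_mult)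

lemma openin_cozero:
  assumes "f \<in> carrier (cont_ring X)"
  shows "openin X (cozero X f)"
proof -
  have "openin X {x \<in> topspace X. f x \<in> - {0}}"
    using assms by (intro openin_continuous_map_preimage) (auto simp: cont_ring_carrier_iff)
  then show ?thesis by (simp add: Collect_conj_eq)
qed

lemma cozero_nonempty:
  assumes "f \<in> carrier (cont_ring X)" "f \<noteq> \<zero>\<^bsub>cont_ring X\<^esub>"
  obtains x where "x \<in> topspace X" "f x \<noteq> 0"
proof -
  interpret cring "cont_ring X" by (rule cring_cont_ring)
  show thesis
    using assms that cont_ring_eqI[of f X "\<zero>\<^bsub>cont_ring X\<^esub>"] by (auto simp: cont_ring_apply)
qed

lemma char_fun_in_cont_ring:
  assumes "openin X A" "closedin X A"
  shows "char_fun X A \<in> carrier (cont_ring X)"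
  unfolding char_fun_def
proof (rule restrict_in_cont_ring)
  have "openin X {x \<in> topspace X. (if x \<in> A then 1 else 0 :: real) \<in> U}" for U
  proof -
    have sub: "A \<subseteq> topspace X" and "openin X (topspace X - A)"
      using assms by (auto simp: openin_subset)
    moreover have "{x \<in> topspace X. (if x \<in> A then 1 else 0 :: real) \<in> U} =
        (if 1 \<in> U then A else {}) \<union> (if 0 \<in> U then topspace X - A else {})"
      using sub by auto
    ultimately show ?thesis using assms(1) by auto
  qed
  then show "continuous_map X euclideanreal (\<lambda>x. if x \<in> A then 1 else 0)"
    by (simp add: continuous_map_def)
qed

lemma isolated_points_subset: "isolated_points X \<subseteq> topspace X"
  by (auto simp: isolated_points_def)

lemma char_fun_finite_in_cont_ring:
  assumes "Hausdorff_space X" "finite A" "A \<subseteq> isolated_points X"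
  shows "char_fun X A \<in> carrier (cont_ring X)"
proof (rule char_fun_in_cont_ring)
  have "openin X (\<Union>x\<in>A. {x})" using assms(3) by (intro openin_Union) (auto simp: isolated_points_def)
  then show "openin X A" by simp
  show "closedin X A"
    using assms isolated_points_subset[of X] by (auto simp: closedin_Hausdorff_finite)
qed

lemma completely_regular_separation:
  assumes "completely_regular_space X" "closedin X S" "x \<in> topspace X - S"
  obtains f where "f \<in> carrier (cont_ring X)" "f x = 1" "\<And>y. y \<in> S \<Longrightarrow> f y = 0"
proof -
  obtain g :: "'a \<Rightarrow> real" where g: "continuous_map X (top_of_set {0..1}) g" "g x = 0" "g ` S \<subseteq> {1}"
    using assms(1)[unfolded completely_regular_space_def, rule_format, OF conjI, OF assms(2,3)] by blast
  then have "continuous_map X euclideanreal g" by (simp add: continuous_map_in_subtopology)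
  then have "continuous_map X euclideanreal (\<lambda>y. 1 - g y)"
    by (intro continuous_map_diff) auto
  moreover have "S \<subseteq> topspace X" using assms(2) by (rule closedin_subset)
  ultimately show thesis
    using that[of "restrict (\<lambda>y. 1 - g y) (topspace X)"] g assms(3) restrict_in_cont_ring[of X "\<lambda>y. 1 - g y"]
    by fastforce
qed

lemma completely_regular_bump:
  assumes "completely_regular_space X" "openin X U" "x \<in> U"
  obtains f where "f \<in> carrier (cont_ring X)" "f x = 1" "\<And>y. y \<in> topspace X - U \<Longrightarrow> f y = 0"
proof (rule completely_regular_separation[OF assms(1)])
  show "closedin X (topspace X - U)" using assms(2) by (rule openin_closedin_eq[THEN iffD1, THEN conjunct2])
  show "x \<in> topspace X - (topspace X - U)" using assms(2,3) openin_subset by blast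
qed (rule that)

section \<open>Minimal primes and essential ideals in commutative rings\<close>

text \<open>
  If \<open>I\<close> meets a nonzero ideal \<open>J\<close> trivially then \<open>I \<otimes> J\<close> is zero, while primality puts whatever kills a
  nonzero element of \<open>J\<close> into \<open>I\<close>. Conversely, a multiple of \<open>j\<close> that is killed by \<open>j\<close> has square zero, so
  in a reduced ring the annihilator of \<open>j\<close> meets the principal ideal of \<open>j\<close> trivially.
\<close>
lemma (in primeideal) essential_ideal_iff:
  assumes red: "\<And>a. \<lbrakk>a \<in> carrier R; a \<otimes> a = \<zero>\<rbrakk> \<Longrightarrow> a = \<zero>"
  shows "essential_ideal I R \<longleftrightarrow>
    (\<forall>j\<in>carrier R. j \<noteq> \<zero> \<longrightarrow> I \<noteq> {p \<in> carrier R. p \<otimes> j = \<zero>})"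
proof -
  have zI: "\<zero> \<in> I" by (rule additive_subgroup.zero_closed) unfold_locales
  have "\<exists>j\<in>carrier R. j \<noteq> \<zero> \<and> I = {p \<in> carrier R. p \<otimes> j = \<zero>}" if ne: "\<not> essential_ideal I R"
  proof -
    have "\<exists>J. ideal J R \<and> J \<noteq> {\<zero>} \<and> I \<inter> J = {\<zero>}"
    \<comment> \<open>The zero prime is inessential by convention; the whole ring then serves as \<open>J\<close>.\<close>
    proof (cases "I = {\<zero>}")
      case True
      have "carrier R \<noteq> {\<zero>}" using I_notcarr True by blast
      then show ?thesis using True oneideal by (intro exI[of _ "carrier R"]) auto
    next
      case False
      then show ?thesis using ne is_ideal by (auto simp: essential_ideal_def)
    qed
    then obtain J where J: "ideal J R" "J \<noteq> {\<zero>}" "I \<inter> J = {\<zero>}" by blast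
    interpret J: ideal J R by (rule J)
    obtain j where j: "j \<in> J" "j \<noteq> \<zero>" using J(2) J.zero_closed by blast
    then have jc: "j \<in> carrier R" and jI: "j \<notin> I" using J(3) J.a_subset by blast+
    have "p \<otimes> j = \<zero>" if p: "p \<in> I" for p
    proof -
      have "p \<otimes> j \<in> I" using I_r_closed[OF p jc] .
      moreover have "p \<otimes> j \<in> J" using J.I_l_closed[OF j(1)] p a_subset by blast
      ultimately show ?thesis using J(3) by blast
    qed
    moreover have "p \<in> I" if "p \<in> carrier R" "p \<otimes> j = \<zero>" for p
      using I_prime[of p j] that jc jI zI by auto
    ultimately show ?thesis using jc j a_subset by blast
  qed
  moreover have "\<not> essential_ideal I R"
    if j: "j \<in> carrier R" "j \<noteq> \<zero>" "I = {p \<in> carrier R. p \<otimes> j = \<zero>}" for j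
  proof
    assume ess: "essential_ideal I R"
    have "PIdl j \<noteq> {\<zero>}" using cgenideal_self j by blast
    then have "I \<inter> PIdl j \<noteq> {\<zero>}"
      using ess cgenideal_ideal j unfolding essential_ideal_def by blast
    moreover have "\<zero> \<in> I \<inter> PIdl j"
      using zI additive_subgroup.zero_closed[OF ideal.axioms(1)[OF cgenideal_ideal[OF j(1)]]] by auto
    ultimately obtain p where p: "p \<in> I" "p \<in> PIdl j" "p \<noteq> \<zero>" by blast
    then obtain r where r: "r \<in> carrier R" "p = r \<otimes> j" by (auto simp: cgenideal_def)
    have "p \<otimes> j = \<zero>" using p(1) j(3) by blast
    have "p \<otimes> p = r \<otimes> (p \<otimes> j)"
      unfolding r(2) using r(1) j(1) by (simp add: m_ac)
    also have "\<dots> = \<zero>" using \<open>p \<otimes> j = \<zero>\<close> r by simp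
    finally show False using red[of p] p(1,3) a_subset by blast
  qed
  ultimately show ?thesis by blast
qed

lemma cring_idealI:
  fixes R (structure)
  assumes "cring R" "I \<subseteq> carrier R" "\<zero> \<in> I"
    and add: "\<And>a b. \<lbrakk>a \<in> I; b \<in> I\<rbrakk> \<Longrightarrow> a \<oplus> b \<in> I"
    and mult: "\<And>r a. \<lbrakk>r \<in> carrier R; a \<in> I\<rbrakk> \<Longrightarrow> r \<otimes> a \<in> I"
  shows "ideal I R"
proof -
  interpret cring R by fact
  show ?thesis
  proof (rule idealI)
    show "ring R" by (rule ring_axioms)
    show "subgroup I (add_monoid R)"
    proof (rule add.subgroupI)
      fix a assume "a \<in> I"
      then have "(\<ominus> \<one>) \<otimes> a \<in> I" by (intro mult) auto
      with \<open>a \<in> I\<close> assms(2) show "\<ominus> a \<in> I" by (auto simp: l_minus)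
    qed (use assms in auto)
    show "x \<otimes> a \<in> I" if "a \<in> I" "x \<in> carrier R" for a x using mult that by auto
    then show "a \<otimes> x \<in> I" if "a \<in> I" "x \<in> carrier R" for a x
      using that assms(2) m_comm by (metis subsetD)
  qed
qed

text \<open>
  In a reduced ring the minimal primes are the complements of the maximal multiplicative sets \<open>M\<close>
  without zero. Maximality enters in one form only: every \<open>a\<close> outside \<open>M\<close> is killed by an element of
  \<open>M\<close>. This yields closure of the complement under sums, and minimality too, since a prime inside
  the complement contains \<open>a \<otimes> s = \<zero>\<close> but not \<open>s\<close>.
\<close>
lemma ex_minimal_prime_ideal_avoiding:
  fixes R (structure)
  assumes "cring R" and red: "\<And>a. \<lbrakk>a \<in> carrier R; a \<otimes> a = \<zero>\<rbrakk> \<Longrightarrow> a = \<zero>"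
    and S: "S \<subseteq> carrier R" "\<one> \<in> S" "\<zero> \<notin> S" "\<And>a b. \<lbrakk>a \<in> S; b \<in> S\<rbrakk> \<Longrightarrow> a \<otimes> b \<in> S"
  obtains P where "minimal_prime_ideal P R" "P \<inter> S = {}"
proof -
  interpret cring R by fact
  define \<M> where "\<M> = {M. S \<subseteq> M \<and> M \<subseteq> carrier R \<and> \<zero> \<notin> M \<and> (\<forall>a\<in>M. \<forall>b\<in>M. a \<otimes> b \<in> M)}"
  have "\<exists>M\<in>\<M>. \<forall>M'\<in>\<M>. M \<subseteq> M' \<longrightarrow> M' = M"
  proof (rule subset_Zorn_nonempty)
    show "\<M> \<noteq> {}" using S by (auto simp: \<M>_def)
    fix \<C> assume ne: "\<C> \<noteq> {}" and ch: "subset.chain \<M> \<C>"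
    then have sub: "\<C> \<subseteq> \<M>" by (simp add: subset.chain_def)
    have "a \<otimes> b \<in> \<Union>\<C>" if ab: "a \<in> \<Union>\<C>" "b \<in> \<Union>\<C>" for a b
    proof -
      obtain A B where AB: "A \<in> \<C>" "B \<in> \<C>" "a \<in> A" "b \<in> B" using ab by blast
      then have "A \<subseteq> B \<or> B \<subseteq> A" using ch by (auto simp: subset_chain_def)
      then obtain M where "M \<in> \<C>" "a \<in> M" "b \<in> M" using AB by blast
      then show ?thesis using sub by (auto simp: \<M>_def)
    qed
    moreover obtain A where A: "A \<in> \<C>" using ne by blast
    moreover have "S \<subseteq> A" using A sub by (auto simp: \<M>_def)
    moreover have "\<Union>\<C> \<subseteq> carrier R" "\<zero> \<notin> \<Union>\<C>" using sub by (auto simp: \<M>_def)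
    ultimately show "\<Union>\<C> \<in> \<M>" unfolding \<M>_def by blast
  qed
  then obtain M where M\<M>: "M \<in> \<M>" and max: "\<And>M'. M' \<in> \<M> \<Longrightarrow> M \<subseteq> M' \<Longrightarrow> M' = M" by blast
  have M: "S \<subseteq> M" "M \<subseteq> carrier R" "\<zero> \<notin> M" "\<And>a b. \<lbrakk>a \<in> M; b \<in> M\<rbrakk> \<Longrightarrow> a \<otimes> b \<in> M"
    using M\<M> by (auto simp: \<M>_def)
  have one: "\<one> \<in> M" using S M by auto
  have kill: "\<exists>s\<in>M. a \<otimes> s = \<zero>" if a: "a \<in> carrier R" "a \<notin> M" for a
  proof (rule ccontr)
    assume no: "\<not> (\<exists>s\<in>M. a \<otimes> s = \<zero>)"
    \<comment> \<open>The enlargement of \<open>M\<close> by \<open>a\<close> is taken to be all \<open>g\<close> whose annihilator is contained in that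
      of some \<open>a \<otimes> s\<close>. In a reduced ring annihilators do not see exponents, so the products of \<open>a\<close>
      with elements of \<open>M\<close> stand for all higher powers of \<open>a\<close> as well.\<close>
    define M' where "M' = {g \<in> carrier R. \<exists>s\<in>M. \<forall>h\<in>carrier R. h \<otimes> g = \<zero> \<longrightarrow> h \<otimes> (a \<otimes> s) = \<zero>}"
    have "M \<subseteq> M'"
    proof
      fix g assume g: "g \<in> M"
      then have gc: "g \<in> carrier R" using M by auto
      have "h \<otimes> (a \<otimes> g) = \<zero>" if "h \<in> carrier R" "h \<otimes> g = \<zero>" for h
      proof -
        have "h \<otimes> (a \<otimes> g) = a \<otimes> (h \<otimes> g)" using that gc a by (simp add: m_lcomm)
        then show ?thesis using that a by simp
      qed
      then show "g \<in> M'" using g gc by (auto simp: M'_def)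
    qed
    moreover have "a \<in> M'"
      using a one by (auto simp: M'_def intro!: bexI[of _ \<one>])
    moreover have "M' \<in> \<M>"
      unfolding \<M>_def
    proof (intro CollectI conjI ballI)
      show "S \<subseteq> M'" using M(1) \<open>M \<subseteq> M'\<close> by blast
      show "M' \<subseteq> carrier R" by (auto simp: M'_def)
      show "\<zero> \<notin> M'"
      proof
        assume "\<zero> \<in> M'"
        then obtain s where "s \<in> M" "\<one> \<otimes> (a \<otimes> s) = \<zero>"
          unfolding M'_def by (auto dest: bspec[of _ _ \<one>])
        then show False using no a M(2) by auto
      qed
      fix g g' assume "g \<in> M'" "g' \<in> M'"
      then obtain s s' where g: "g \<in> carrier R" "g' \<in> carrier R" "s \<in> M" "s' \<in> M"
        and s: "\<And>h. \<lbrakk>h \<in> carrier R; h \<otimes> g = \<zero>\<rbrakk> \<Longrightarrow> h \<otimes> (a \<otimes> s) = \<zero>"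
        and s': "\<And>h. \<lbrakk>h \<in> carrier R; h \<otimes> g' = \<zero>\<rbrakk> \<Longrightarrow> h \<otimes> (a \<otimes> s') = \<zero>"
        unfolding M'_def by blast
      have sc: "s \<in> carrier R" "s' \<in> carrier R" using g M by auto
      have "h \<otimes> (a \<otimes> (s \<otimes> s')) = \<zero>" if h: "h \<in> carrier R" "h \<otimes> (g \<otimes> g') = \<zero>" for h
      proof (rule red)
        have "(h \<otimes> g) \<otimes> g' = \<zero>" using h g by (simp add: m_assoc)
        then have "(h \<otimes> g) \<otimes> (a \<otimes> s') = \<zero>" using s' h g by simp
        then have "(h \<otimes> (a \<otimes> s')) \<otimes> g = \<zero>" using h g a sc by (simp add: m_ac)
        then have 0: "(h \<otimes> (a \<otimes> s')) \<otimes> (a \<otimes> s) = \<zero>" using s h a sc by simp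
        have "(h \<otimes> (a \<otimes> (s \<otimes> s'))) \<otimes> (h \<otimes> (a \<otimes> (s \<otimes> s')))
            = ((h \<otimes> (a \<otimes> s')) \<otimes> (a \<otimes> s)) \<otimes> (h \<otimes> (s \<otimes> s'))"
          using h a sc by (simp add: m_ac)
        then show "(h \<otimes> (a \<otimes> (s \<otimes> s'))) \<otimes> (h \<otimes> (a \<otimes> (s \<otimes> s'))) = \<zero>"
          using 0 h sc by simp
      qed (use h a sc in auto)
      then show "g \<otimes> g' \<in> M'" using g M(4) by (auto simp: M'_def)
    qed
    ultimately show False using max a by blast
  qed
  define P where "P = carrier R - M"
  have idl: "ideal P R"
  proof (rule cring_idealI[OF \<open>cring R\<close>])
    fix a b assume "a \<in> P" "b \<in> P"
    then have ab: "a \<in> carrier R" "a \<notin> M" "b \<in> carrier R" "b \<notin> M" by (auto simp: P_def)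
    obtain s t where st: "a \<in> carrier R" "b \<in> carrier R" "s \<in> M" "t \<in> M" "a \<otimes> s = \<zero>" "b \<otimes> t = \<zero>"
      using kill[OF ab(1,2)] kill[OF ab(3,4)] ab(1,3) by blast
    then have c: "s \<in> carrier R" "t \<in> carrier R" using M by auto
    have "a \<otimes> (s \<otimes> t) = (a \<otimes> s) \<otimes> t" "b \<otimes> (s \<otimes> t) = (b \<otimes> t) \<otimes> s"
      using st(1,2) c by (simp_all add: m_ac)
    then have "(a \<oplus> b) \<otimes> (s \<otimes> t) = \<zero>" using st c by (simp add: l_distr)
    then show "a \<oplus> b \<in> P" using M(3,4) st unfolding P_def by (metis DiffI a_closed)
  next
    fix r a assume r: "r \<in> carrier R" and "a \<in> P"
    then obtain s where s: "a \<in> carrier R" "s \<in> M" "a \<otimes> s = \<zero>"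
      using kill unfolding P_def by blast
    then have "(r \<otimes> a) \<otimes> s = \<zero>" using r M(2) by (simp add: m_assoc subset_iff)
    then show "r \<otimes> a \<in> P" using M(3,4) r s unfolding P_def by (metis DiffI m_closed)
  qed (use M(3) in \<open>auto simp: P_def\<close>)
  have prm: "primeideal P R"
  proof (rule primeidealI[OF idl])
    show "cring R" by fact
    show "carrier R \<noteq> P" using one M(2) by (auto simp: P_def)
    show "a \<in> P \<or> b \<in> P" if "a \<in> carrier R" "b \<in> carrier R" "a \<otimes> b \<in> P" for a b
      using that M(4) by (auto simp: P_def)
  qed
  have "Q = P" if Q: "primeideal Q R" "Q \<subseteq> P" for Q
  proof
    interpret Q: primeideal Q R by (rule Q)
    show "P \<subseteq> Q"
    proof
      fix a assume "a \<in> P"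
      then obtain s where s: "a \<in> carrier R" "s \<in> M" "a \<otimes> s = \<zero>"
        using kill unfolding P_def by blast
      then have "s \<notin> Q" using Q(2) by (auto simp: P_def)
      moreover have "a \<in> Q \<or> s \<in> Q"
        using s M(2) Q.zero_closed by (intro Q.I_prime) auto
      ultimately show "a \<in> Q" by blast
    qed
  qed (rule Q)
  with prm have "minimal_prime_ideal P R" by (auto simp: minimal_prime_ideal_def)
  moreover have "P \<inter> S = {}" using M(1) by (auto simp: P_def)
  ultimately show ?thesis by (rule that)
qed

lemma essential_ideal_mono:
  fixes R (structure)
  assumes "essential_ideal E R" "E \<subseteq> E'" "ideal E' R"
  shows "essential_ideal E' R"
proof -
  have E: "ideal E R" "E \<noteq> {\<zero>}" "\<And>J. ideal J R \<Longrightarrow> J \<noteq> {\<zero>} \<Longrightarrow> E \<inter> J \<noteq> {\<zero>}"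
    using assms(1) by (auto simp: essential_ideal_def)
  have zero: "\<zero> \<in> J" if "ideal J R" for J
    using that by (simp add: additive_subgroup.zero_closed ideal.axioms(1))
  have "E' \<noteq> {\<zero>}" using E(1,2) assms(2) zero by blast
  moreover have "E' \<inter> J \<noteq> {\<zero>}" if "ideal J R" "J \<noteq> {\<zero>}" for J
    using E(1) E(3)[OF that] zero[OF E(1)] zero[OF that(1)] assms(2) by blast
  ultimately show ?thesis using assms(3) by (simp add: essential_ideal_def)
qed

lemma ideal_ideal_Inter:
  fixes R (structure)
  assumes "ring R" and "\<And>I. I \<in> \<F> \<Longrightarrow> ideal I R"
  shows "ideal (ideal_Inter R \<F>) R"
proof -
  interpret ring R by fact
  have "ideal (\<Inter>(insert (carrier R) \<F>)) R"
    using assms oneideal by (intro i_Intersect) auto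
  then show ?thesis by (simp add: ideal_Inter_def)
qed

section \<open>Functions with finite cozero set\<close>

lemma finite_openin_subset_isolated_points:
  assumes "Hausdorff_space X" "finite A" "openin X A"
  shows "A \<subseteq> isolated_points X"
proof
  fix x assume x: "x \<in> A"
  have sub: "A \<subseteq> topspace X" using assms openin_subset by blast
  have "closedin X (A - {x})"
    using assms sub by (auto intro: closedin_Hausdorff_finite)
  then have "openin X (A - (A - {x}))" using assms(3) by (rule openin_diff[rotated])
  moreover have "A - (A - {x}) = {x}" using x by auto
  ultimately show "x \<in> isolated_points X" using x sub by (auto simp: isolated_points_def)
qed

lemma ideal_C_F: "ideal (C_F X) (cont_ring X)"
proof -
  interpret cring "cont_ring X" by (rule cring_cont_ring)
  show ?thesis
  proof (rule cring_idealI[OF cring_cont_ring])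
    fix f g assume fg: "f \<in> C_F X" "g \<in> C_F X"
    then show "f \<oplus>\<^bsub>cont_ring X\<^esub> g \<in> C_F X"
      by (auto simp: C_F_iff cont_ring_apply intro: finite_subset[of _ "cozero X f \<union> cozero X g"])
  next
    fix r f assume "r \<in> carrier (cont_ring X)" "f \<in> C_F X"
    then show "r \<otimes>\<^bsub>cont_ring X\<^esub> f \<in> C_F X"
      by (auto simp: C_F_iff cont_ring_apply intro: finite_subset[of _ "cozero X f"])
  next
    have "cozero X \<zero>\<^bsub>cont_ring X\<^esub> = {}" by (auto simp: cont_ring_apply)
    then show "\<zero>\<^bsub>cont_ring X\<^esub> \<in> C_F X" unfolding C_F_iff by (metis finite.emptyI zero_closed)
  qed (auto simp: C_F_iff)
qed

lemma C_F_cozero_isolated: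
  assumes "Hausdorff_space X" "f \<in> C_F X"
  shows "cozero X f \<subseteq> isolated_points X"
proof (rule finite_openin_subset_isolated_points[OF assms(1)])
  show "finite (cozero X f)" using assms(2) by (simp add: C_F_iff)
  show "openin X (cozero X f)" using assms(2) by (intro openin_cozero) (simp add: C_F_iff)
qed

lemma char_fun_in_C_F:
  assumes "Hausdorff_space X" "finite A" "A \<subseteq> isolated_points X"
  shows "char_fun X A \<in> C_F X"
proof -
  have "cozero X (char_fun X A) \<subseteq> A" by (auto simp: char_fun_def split: if_splits)
  then have "finite (cozero X (char_fun X A))" using assms(2) by (rule finite_subset)
  then show ?thesis using char_fun_finite_in_cont_ring[OF assms] by (simp add: C_F_iff)
qed

text \<open>
  A function with finite cozero set is a multiple of the characteristic function of that set, which
  is a finite sum of characteristic functions of isolated points.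
\<close>
lemma C_F_subset_ideal:
  assumes H: "Hausdorff_space X" and P: "ideal P (cont_ring X)"
    and char: "\<And>x. x \<in> isolated_points X \<Longrightarrow> char_fun X {x} \<in> P"
  shows "C_F X \<subseteq> P"
proof
  interpret cring "cont_ring X" by (rule cring_cont_ring)
  interpret P: ideal P "cont_ring X" by (rule P)
  have charA: "char_fun X A \<in> P" if "finite A" "A \<subseteq> isolated_points X" for A
    using that
  proof (induction A)
    case empty
    have "char_fun X {} = \<zero>\<^bsub>cont_ring X\<^esub>"
      by (rule cont_ring_eqI) (use char_fun_finite_in_cont_ring[OF H, of "{}"] in \<open>auto simp: cont_ring_apply\<close>)
    then show ?case using P.zero_closed by simp
  next
    case (insert x A)
    have carr: "char_fun X B \<in> carrier (cont_ring X)" if "B \<subseteq> insert x A" for B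
      using that insert.hyps(1) insert.prems
      by (intro char_fun_finite_in_cont_ring[OF H]) (auto intro: finite_subset)
    have "char_fun X (insert x A) = char_fun X {x} \<oplus>\<^bsub>cont_ring X\<^esub> char_fun X A"
    proof (rule cont_ring_eqI[of _ X])
      show "char_fun X (insert x A) \<in> carrier (cont_ring X)" by (rule carr) simp
      show "char_fun X {x} \<oplus>\<^bsub>cont_ring X\<^esub> char_fun X A \<in> carrier (cont_ring X)"
        by (intro a_closed carr) auto
    qed (use insert.hyps(2) in \<open>auto simp: cont_ring_apply\<close>)
    moreover have "char_fun X {x} \<in> P" "char_fun X A \<in> P"
      using insert.IH insert.prems char by simp_all
    ultimately show ?case using P.a_closed by simp
  qed
  fix f assume f: "f \<in> C_F X"
  let ?e = "char_fun X (cozero X f)"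
  have e: "finite (cozero X f)" "cozero X f \<subseteq> isolated_points X"
    using f C_F_cozero_isolated[OF H f] by (auto simp: C_F_iff)
  have fc: "f \<in> carrier (cont_ring X)" using f by (simp add: C_F_iff)
  have "f = f \<otimes>\<^bsub>cont_ring X\<^esub> ?e"
    by (rule cont_ring_eqI[of _ X]) (use fc char_fun_finite_in_cont_ring[OF H e] in \<open>auto simp: cont_ring_apply\<close>)
  then show "f \<in> P" using P.I_l_closed[OF charA[OF e] fc] by simp
qed

section \<open>Essential minimal primes of the ring of continuous functions\<close>

text \<open>
  If \<open>j\<close> were nonzero at two points, disjointly supported bumps at these points would have product
  zero without either of them annihilating \<open>j\<close>. The cozero set of \<open>j\<close> is thus an open singleton.
\<close>
lemma prime_annihilator_cozero:
  assumes X: "completely_regular_space X" "Hausdorff_space X"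
    and j: "j \<in> carrier (cont_ring X)" "j \<noteq> \<zero>\<^bsub>cont_ring X\<^esub>"
    and P: "primeideal P (cont_ring X)"
    and ann: "P = {p \<in> carrier (cont_ring X). p \<otimes>\<^bsub>cont_ring X\<^esub> j = \<zero>\<^bsub>cont_ring X\<^esub>}"
  obtains x where "x \<in> isolated_points X" "j x \<noteq> 0"
proof -
  let ?R = "cont_ring X"
  interpret P: primeideal P ?R by (rule P)
  obtain x where x: "x \<in> topspace X" "j x \<noteq> 0" using j by (rule cozero_nonempty)
  have "y = x" if y: "y \<in> topspace X" "j y \<noteq> 0" for y
  proof (rule ccontr)
    assume "y \<noteq> x"
    then obtain U V where UV: "openin X U" "openin X V" "x \<in> U" "y \<in> V" "disjnt U V"
      using X(2) x y unfolding Hausdorff_space_def by metis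
    obtain f where f: "f \<in> carrier ?R" "f x = 1" "\<And>z. z \<in> topspace X - U \<Longrightarrow> f z = 0"
      using completely_regular_bump[OF X(1) UV(1,3)] by blast
    obtain g where g: "g \<in> carrier ?R" "g y = 1" "\<And>z. z \<in> topspace X - V \<Longrightarrow> g z = 0"
      using completely_regular_bump[OF X(1) UV(2,4)] by blast
    have "f \<otimes>\<^bsub>?R\<^esub> g = \<zero>\<^bsub>?R\<^esub>"
    proof (rule cont_ring_eqI[of _ X])
      fix z assume z: "z \<in> topspace X"
      then have "f z = 0 \<or> g z = 0" using f(3) g(3) UV(5) by (auto simp: disjnt_iff)
      then show "(f \<otimes>\<^bsub>?R\<^esub> g) z = \<zero>\<^bsub>?R\<^esub> z" using z by (auto simp: cont_ring_apply)
    qed (use f(1) g(1) in simp_all)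
    then have "f \<otimes>\<^bsub>?R\<^esub> g \<in> P" using P.zero_closed by simp
    then have "f \<in> P \<or> g \<in> P" by (rule P.I_prime[OF f(1) g(1)])
    then have "f \<otimes>\<^bsub>?R\<^esub> j = \<zero>\<^bsub>?R\<^esub> \<or> g \<otimes>\<^bsub>?R\<^esub> j = \<zero>\<^bsub>?R\<^esub>" unfolding ann by blast
    then have "(f \<otimes>\<^bsub>?R\<^esub> j) x = \<zero>\<^bsub>?R\<^esub> x \<or> (g \<otimes>\<^bsub>?R\<^esub> j) y = \<zero>\<^bsub>?R\<^esub> y" by metis
    then show False using f(2) g(2) x y by (simp add: cont_ring_apply)
  qed
  then have "cozero X j = {x}" using x by blast
  then have "x \<in> isolated_points X" using openin_cozero[OF j(1)] x by (simp add: isolated_points_def)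
  then show ?thesis using x that by blast
qed

text \<open>
  The inessential primes are the annihilators of nonzero functions, hence of functions that
  live at one isolated point \<open>x\<close>. A prime that misses the characteristic function of \<open>{x}\<close> is the
  annihilator of this function, and an annihilator of a function that is nonzero at \<open>x\<close> misses it.
\<close>
lemma essential_prime_iff_char_fun:
  assumes X: "completely_regular_space X" "Hausdorff_space X" and P: "primeideal P (cont_ring X)"
  shows "essential_ideal P (cont_ring X) \<longleftrightarrow> (\<forall>x\<in>isolated_points X. char_fun X {x} \<in> P)"
proof -
  let ?R = "cont_ring X"
  interpret P: primeideal P ?R by (rule P)
  have char: "char_fun X {x} \<in> carrier ?R" if "x \<in> isolated_points X" for x
    using char_fun_finite_in_cont_ring[OF X(2), of "{x}"] that by simp
  have ess: "essential_ideal P ?R \<longleftrightarrow>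
    (\<forall>j\<in>carrier ?R. j \<noteq> \<zero>\<^bsub>?R\<^esub> \<longrightarrow> P \<noteq> {p \<in> carrier ?R. p \<otimes>\<^bsub>?R\<^esub> j = \<zero>\<^bsub>?R\<^esub>})"
    by (rule P.essential_ideal_iff) (use cont_ring_reduced in auto)
  show ?thesis
  proof (intro iffI ballI)
    fix x assume E: "essential_ideal P ?R" and x: "x \<in> isolated_points X"
    let ?c = "char_fun X {x}"
    have xt: "x \<in> topspace X" using x isolated_points_subset[of X] by blast
    show "?c \<in> P"
    proof (rule ccontr)
      assume c: "?c \<notin> P"
      have "p \<otimes>\<^bsub>?R\<^esub> ?c = \<zero>\<^bsub>?R\<^esub>" if p: "p \<in> P" for p
      proof -
        have pc: "p \<in> carrier ?R" using p P.a_subset by blast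
        have "p x = 0"
        proof (rule ccontr)
          assume px: "p x \<noteq> 0"
          \<comment> \<open>Otherwise the characteristic function would be a multiple of \<open>p\<close> and lie in \<open>P\<close>.\<close>
          let ?d = "\<lambda>y\<in>topspace X. inverse (p x) * ?c y"
          have d: "?d \<in> carrier ?R" using char[OF x] by (rule scaled_in_cont_ring)
          have "?c = ?d \<otimes>\<^bsub>?R\<^esub> p"
            by (rule cont_ring_eqI[of _ X]) (use d pc px char[OF x] in \<open>auto simp: cont_ring_apply\<close>)
          then show False using c P.I_l_closed[OF p d] by simp
        qed
        then show ?thesis
          by (intro cont_ring_eqI[of _ X]) (use pc char[OF x] in \<open>auto simp: cont_ring_apply\<close>)
      qed
      moreover have "p \<in> P" if "p \<in> carrier ?R" "p \<otimes>\<^bsub>?R\<^esub> ?c = \<zero>\<^bsub>?R\<^esub>" for p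
        using P.I_prime[of p ?c] that char[OF x] c P.zero_closed by auto
      ultimately have "P = {p \<in> carrier ?R. p \<otimes>\<^bsub>?R\<^esub> ?c = \<zero>\<^bsub>?R\<^esub>}" using P.a_subset by blast
      moreover have "?c \<noteq> \<zero>\<^bsub>?R\<^esub>" using c P.zero_closed by auto
      ultimately show False using E ess char[OF x] by blast
    qed
  next
    assume all: "\<forall>x\<in>isolated_points X. char_fun X {x} \<in> P"
    have "P \<noteq> {p \<in> carrier ?R. p \<otimes>\<^bsub>?R\<^esub> j = \<zero>\<^bsub>?R\<^esub>}"
      if j: "j \<in> carrier ?R" "j \<noteq> \<zero>\<^bsub>?R\<^esub>" for j
    proof
      assume eq: "P = {p \<in> carrier ?R. p \<otimes>\<^bsub>?R\<^esub> j = \<zero>\<^bsub>?R\<^esub>}"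
      obtain x where x: "x \<in> isolated_points X" "j x \<noteq> 0"
        using prime_annihilator_cozero[OF X j P eq] by blast
      have xt: "x \<in> topspace X" using x isolated_points_subset[of X] by blast
      have "char_fun X {x} \<otimes>\<^bsub>?R\<^esub> j = \<zero>\<^bsub>?R\<^esub>" using all x eq by blast
      then have "(char_fun X {x} \<otimes>\<^bsub>?R\<^esub> j) x = \<zero>\<^bsub>?R\<^esub> x" by simp
      then show False using x(2) xt by (simp add: cont_ring_apply)
    qed
    then show "essential_ideal P ?R" unfolding ess by blast
  qed
qed

text \<open>
  The inclusion from left to right needs, for each \<open>f\<close> with infinite cozero set, an essential minimal
  prime missing \<open>f\<close>. It suffices to avoid a multiplicative set containing \<open>f\<close> together with the
  complementary idempotents of all isolated points.
\<close>
lemma Inter_essential_minimal_primes_eq_C_F: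
  assumes X: "completely_regular_space X" "Hausdorff_space X"
  shows "ideal_Inter (cont_ring X) (essential_minimal_primes (cont_ring X)) = C_F X"
proof
  let ?R = "cont_ring X"
  interpret cring ?R by (rule cring_cont_ring)
  show "C_F X \<subseteq> ideal_Inter ?R (essential_minimal_primes ?R)"
  proof -
    have "C_F X \<subseteq> P" if P: "P \<in> essential_minimal_primes ?R" for P
    proof -
      have prm: "primeideal P ?R" and ess: "essential_ideal P ?R"
        using P by (auto simp: essential_minimal_primes_def minimal_prime_ideal_def)
      show ?thesis
        using essential_prime_iff_char_fun[OF X prm] ess
        by (intro C_F_subset_ideal[OF X(2)]) (auto simp: primeideal.axioms(1)[OF prm])
    qed
    then show ?thesis by (auto simp: ideal_Inter_def C_F_iff)
  qed
  show "ideal_Inter ?R (essential_minimal_primes ?R) \<subseteq> C_F X"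
  proof
    fix f assume f: "f \<in> ideal_Inter ?R (essential_minimal_primes ?R)"
    then have fc: "f \<in> carrier ?R" by (simp add: ideal_Inter_def)
    show "f \<in> C_F X"
    proof (rule ccontr)
      assume "f \<notin> C_F X"
      then have inf: "infinite (cozero X f)" using fc by (simp add: C_F_iff)
      \<comment> \<open>Zero is not in \<open>S\<close> exactly because the cozero set of \<open>f\<close> is infinite.\<close>
      define S where "S = {g \<in> carrier ?R. finite (cozero X f - cozero X g)}"
      obtain P where P: "minimal_prime_ideal P ?R" "P \<inter> S = {}"
      proof (rule ex_minimal_prime_ideal_avoiding[OF cring_cont_ring])
        show "S \<subseteq> carrier ?R" by (auto simp: S_def)
        have "cozero X f - cozero X \<one>\<^bsub>?R\<^esub> = {}" by (auto simp: cont_ring_apply)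
        then have "finite (cozero X f - cozero X \<one>\<^bsub>?R\<^esub>)" by (metis finite.emptyI)
        then show "\<one>\<^bsub>?R\<^esub> \<in> S" by (simp add: S_def)
        have "cozero X f - cozero X \<zero>\<^bsub>?R\<^esub> = cozero X f" by (auto simp: cont_ring_apply)
        then have "infinite (cozero X f - cozero X \<zero>\<^bsub>?R\<^esub>)" using inf by metis
        then show "\<zero>\<^bsub>?R\<^esub> \<notin> S" by (simp add: S_def)
        show "g \<otimes>\<^bsub>?R\<^esub> h \<in> S" if "g \<in> S" "h \<in> S" for g h
        proof -
          have "cozero X f - cozero X (g \<otimes>\<^bsub>?R\<^esub> h) = (cozero X f - cozero X g) \<union> (cozero X f - cozero X h)"
            by (auto simp: cont_ring_apply)
          moreover have "finite ((cozero X f - cozero X g) \<union> (cozero X f - cozero X h))"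
            using that by (simp add: S_def)
          ultimately have "finite (cozero X f - cozero X (g \<otimes>\<^bsub>?R\<^esub> h))" by metis
          then show ?thesis using that by (simp add: S_def)
        qed
      qed (use cont_ring_reduced in auto)
      have prm: "primeideal P ?R" using P(1) by (simp add: minimal_prime_ideal_def)
      interpret P: primeideal P ?R by (rule prm)
      have "char_fun X {x} \<in> P" if x: "x \<in> isolated_points X" for x
      proof -
        let ?c = "char_fun X {x}"
        let ?d = "\<one>\<^bsub>?R\<^esub> \<ominus>\<^bsub>?R\<^esub> ?c"
        have c: "?c \<in> carrier ?R" using char_fun_finite_in_cont_ring[OF X(2), of "{x}"] x by simp
        have d: "?d \<in> carrier ?R" using c by simp
        have sum: "?d \<oplus>\<^bsub>?R\<^esub> ?c = \<one>\<^bsub>?R\<^esub>" using c by (simp add: minus_eq a_assoc l_neg)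
        have d_apply: "?d y = (if y = x then 0 else 1)" if y: "y \<in> topspace X" for y
          using fun_cong[OF sum, of y] y by (auto simp: cont_ring_apply split: if_splits)
        have "?c \<otimes>\<^bsub>?R\<^esub> ?d = \<zero>\<^bsub>?R\<^esub>"
          by (rule cont_ring_eqI[of _ X]) (use c d in \<open>auto simp: cont_ring_apply d_apply\<close>)
        moreover have "?d \<in> S"
        proof -
          have "cozero X f - cozero X ?d \<subseteq> {x}" by (auto simp: d_apply)
          then have "finite (cozero X f - cozero X ?d)" by (rule finite_subset) simp
          then show ?thesis using d by (simp add: S_def)
        qed
        ultimately show ?thesis using P.I_prime[of ?c ?d] c d P(2) P.zero_closed by auto
      qed
      then have "P \<in> essential_minimal_primes ?R"
        using P(1) essential_prime_iff_char_fun[OF X prm] by (simp add: essential_minimal_primes_def)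
      then have "f \<in> P" using f by (simp add: ideal_Inter_def)
      moreover have "f \<in> S" using fc by (simp add: S_def)
      ultimately show False using P(2) by blast
    qed
  qed
qed

section \<open>The socle\<close>

definition point_ideal :: "'a topology \<Rightarrow> 'a \<Rightarrow> ('a \<Rightarrow> real) set" where
  "point_ideal X x = {f \<in> carrier (cont_ring X). \<forall>y\<in>topspace X. y \<noteq> x \<longrightarrow> f y = 0}"

lemma minimal_ideal_point_ideal:
  assumes H: "Hausdorff_space X" and x: "x \<in> isolated_points X"
  shows "minimal_ideal (point_ideal X x) (cont_ring X)"
proof -
  let ?R = "cont_ring X"
  interpret cring ?R by (rule cring_cont_ring)
  have xt: "x \<in> topspace X" using x isolated_points_subset[of X] by blast
  have idl: "ideal (point_ideal X x) ?R"
    by (rule cring_idealI[OF cring_cont_ring]) (auto simp: point_ideal_def cont_ring_apply)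
  have "char_fun X {x} \<in> point_ideal X x"
    using char_fun_finite_in_cont_ring[OF H, of "{x}"] x by (auto simp: point_ideal_def cont_ring_apply)
  moreover have "char_fun X {x} \<noteq> \<zero>\<^bsub>?R\<^esub>"
    using xt by (metis cont_ring_apply(4,5) insertI1 zero_neq_one)
  ultimately have ne: "point_ideal X x \<noteq> {\<zero>\<^bsub>?R\<^esub>}" by blast
  have "J = point_ideal X x" if J: "ideal J ?R" "J \<subseteq> point_ideal X x" "J \<noteq> {\<zero>\<^bsub>?R\<^esub>}" for J
  proof
    interpret J: ideal J ?R by (rule J)
    obtain j where j: "j \<in> J" "j \<noteq> \<zero>\<^bsub>?R\<^esub>" using J(3) J.zero_closed by blast
    then have jc: "j \<in> carrier ?R" "\<And>y. y \<in> topspace X \<Longrightarrow> y \<noteq> x \<Longrightarrow> j y = 0" using J(2) by (auto simp: point_ideal_def)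
    then have jx: "j x \<noteq> 0" using cozero_nonempty[OF jc(1) j(2)] by metis
    show "point_ideal X x \<subseteq> J"
    proof
      fix h assume "h \<in> point_ideal X x"
      then have h: "h \<in> carrier ?R" "\<And>y. y \<in> topspace X \<Longrightarrow> y \<noteq> x \<Longrightarrow> h y = 0" by (auto simp: point_ideal_def)
      let ?d = "\<lambda>y\<in>topspace X. inverse (j x) * h y"
      have d: "?d \<in> carrier ?R" using h(1) by (rule scaled_in_cont_ring)
      have "h = ?d \<otimes>\<^bsub>?R\<^esub> j"
      proof (rule cont_ring_eqI[of _ X])
        fix y assume y: "y \<in> topspace X"
        then show "h y = (?d \<otimes>\<^bsub>?R\<^esub> j) y"
          using h(2)[OF y] jc(2)[OF y] jx by (cases "y = x") (simp_all add: cont_ring_apply)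
      qed (use h jc d in simp_all)
      then show "h \<in> J" using J.I_l_closed[OF j(1) d] by simp
    qed
  qed (rule J)
  with idl ne show ?thesis by (auto simp: minimal_ideal_def)
qed

text \<open>
  If \<open>f\<close> in a minimal ideal were nonzero at \<open>x\<close> and at \<open>y\<close>, then multiplying it by a function with value
  \<open>1\<close> at \<open>x\<close> and \<open>0\<close> at \<open>y\<close> would give a nonzero element of the ideal that generates only functions
  vanishing at \<open>y\<close>, hence a smaller nonzero ideal.
\<close>
lemma minimal_ideal_subset_C_F:
  assumes X: "completely_regular_space X" "Hausdorff_space X" and I: "minimal_ideal I (cont_ring X)"
  shows "I \<subseteq> C_F X"
proof
  let ?R = "cont_ring X"
  interpret cring ?R by (rule cring_cont_ring)
  interpret I: ideal I ?R using I by (simp add: minimal_ideal_def)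
  fix f assume f: "f \<in> I"
  then have fc: "f \<in> carrier ?R" using I.a_subset by blast
  have "y = x" if xy: "x \<in> topspace X" "f x \<noteq> 0" "y \<in> topspace X" "f y \<noteq> 0" for x y
  proof (rule ccontr)
    assume "y \<noteq> x"
    moreover have "closedin X {y}" using X(2) xy by (simp add: closedin_Hausdorff_singleton)
    ultimately obtain h where h: "h \<in> carrier ?R" "h x = 1" "h y = 0"
      using completely_regular_separation[OF X(1), of "{y}" x] xy by auto
    let ?g = "h \<otimes>\<^bsub>?R\<^esub> f"
    have gI: "?g \<in> I" using I.I_l_closed f h by blast
    have gc: "?g \<in> carrier ?R" using h fc by simp
    have "?g \<noteq> \<zero>\<^bsub>?R\<^esub>" using xy h by (metis cont_ring_apply(1,4) mult_cancel_right1 mult_eq_0_iff)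
    then have "PIdl\<^bsub>?R\<^esub> ?g \<noteq> {\<zero>\<^bsub>?R\<^esub>}" using cgenideal_self[OF gc] by blast
    moreover have "PIdl\<^bsub>?R\<^esub> ?g \<subseteq> I" using gI I.I_l_closed by (auto simp: cgenideal_def)
    ultimately have "PIdl\<^bsub>?R\<^esub> ?g = I" using I cgenideal_ideal[OF gc] by (auto simp: minimal_ideal_def)
    then obtain r where "f = r \<otimes>\<^bsub>?R\<^esub> ?g" using f by (auto simp: cgenideal_def)
    then have "f y = (r \<otimes>\<^bsub>?R\<^esub> ?g) y" by simp
    then show False using xy h by (simp add: cont_ring_apply)
  qed
  then have "\<exists>x. cozero X f \<subseteq> {x}" by blast
  then show "f \<in> C_F X" using fc by (auto simp: C_F_iff intro: finite_subset)
qed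

lemma C_F_eq_socle:
  assumes X: "completely_regular_space X" "Hausdorff_space X"
  shows "C_F X = socle (cont_ring X)"
proof
  let ?R = "cont_ring X"
  interpret cring ?R by (rule cring_cont_ring)
  interpret C_F: ideal "C_F X" ?R by (rule ideal_C_F)
  show "socle ?R \<subseteq> C_F X"
  proof
    fix f assume "f \<in> socle ?R"
    then obtain F a where f: "f = finsum ?R a F" "finite F"
      and min: "\<forall>I\<in>F. minimal_ideal I ?R \<and> a I \<in> I"
      unfolding socle_def by blast
    have a: "a I \<in> C_F X" if "I \<in> F" for I
      using minimal_ideal_subset_C_F[OF X, of I] min that by blast
    from f(2) a have "finsum ?R a F \<in> C_F X"
    proof (induction F)
      case (insert I F)
      have "a J \<in> carrier ?R" if "J \<in> insert I F" for J
        using insert.prems[OF that] by (simp add: C_F_iff)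
      then have "a \<in> F \<rightarrow> carrier ?R" "a I \<in> carrier ?R" by simp_all
      then show ?case using insert by (simp add: finsum_insert)
    qed (simp add: C_F.zero_closed)
    then show "f \<in> C_F X" by (simp add: f(1))
  qed
  show "C_F X \<subseteq> socle ?R"
  proof
    fix f assume f: "f \<in> C_F X"
    define A where "A = cozero X f"
    have A: "finite A" "A \<subseteq> isolated_points X" and fc: "f \<in> carrier ?R"
      using f C_F_cozero_isolated[OF X(2) f] by (simp_all add: C_F_iff A_def)
    have c: "char_fun X {x} \<in> carrier ?R" "char_fun X {x} \<in> point_ideal X y \<longleftrightarrow> x = y" if "x \<in> A" for x y
      using char_fun_finite_in_cont_ring[OF X(2), of "{x}"] that A isolated_points_subset[of X]
      by (auto simp: point_ideal_def char_fun_def)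
    have inj: "inj_on (point_ideal X) A"
      by (rule inj_onI) (metis c(2))
    \<comment> \<open>The socle sums over a set of ideals, so the summand at a point has to be recovered from the
      ideal of that point.\<close>
    define a where "a I = f \<otimes>\<^bsub>?R\<^esub> char_fun X {the_inv_into A (point_ideal X) I}" for I
    have a_point: "a (point_ideal X x) = f \<otimes>\<^bsub>?R\<^esub> char_fun X {x}" if "x \<in> A" for x
      using the_inv_into_f_f[OF inj that] by (simp add: a_def)
    let ?F = "point_ideal X ` A"
    have a: "a I \<in> carrier ?R \<and> a I \<in> I \<and> minimal_ideal I ?R" if I: "I \<in> ?F" for I
    proof -
      obtain x where x: "x \<in> A" "I = point_ideal X x" using I by blast
      have "minimal_ideal I ?R" using x A minimal_ideal_point_ideal[OF X(2)] by blast
      moreover have "f \<otimes>\<^bsub>?R\<^esub> char_fun X {x} \<in> I"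
        using x(2) c[OF x(1)] fc by (auto simp: point_ideal_def cont_ring_apply)
      ultimately show ?thesis using x a_point c fc by (auto simp: point_ideal_def)
    qed
    have "f = finsum ?R a ?F"
    proof (rule cont_ring_eqI[of _ X])
      fix y assume y: "y \<in> topspace X"
      have "finsum ?R a ?F y = (\<Sum>I\<in>?F. a I y)"
        using A a y by (intro finsum_cont_ring_apply) auto
      also have "\<dots> = (\<Sum>x\<in>A. a (point_ideal X x) y)"
        using inj by (simp add: sum.reindex)
      also have "\<dots> = (\<Sum>x\<in>A. if y = x then f y else 0)"
        using y by (intro sum.cong) (auto simp: a_point cont_ring_apply)
      also have "\<dots> = f y" using A y by (auto simp: sum.delta A_def)
      finally show "f y = finsum ?R a ?F y" by simp
    qed (use fc a in \<open>auto intro!: finsum_closed\<close>)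
    then show "f \<in> socle ?R" unfolding socle_def using A a by blast
  qed
qed

section \<open>Density of the isolated points\<close>

text \<open>
  Every nonzero ideal contains a function with nonempty open cozero set; if this set has an
  isolated point \<open>x\<close>, restriction of the function to \<open>x\<close> gives a nonzero element of \<open>C_F X\<close> in the ideal. If
  the isolated points are not dense, a function vanishing on their closure generates an ideal
  meeting \<open>C_F X\<close> trivially.
\<close>
lemma essential_C_F_iff:
  assumes X: "completely_regular_space X" "Hausdorff_space X" and ne: "topspace X \<noteq> {}"
  shows "essential_ideal (C_F X) (cont_ring X) \<longleftrightarrow> X closure_of (isolated_points X) = topspace X"
proof
  let ?R = "cont_ring X"
  interpret cring ?R by (rule cring_cont_ring)
  have zero: "\<zero>\<^bsub>?R\<^esub> \<in> J" if "ideal J ?R" for J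
    using that by (simp add: additive_subgroup.zero_closed ideal.axioms(1))
  {
    assume ess: "essential_ideal (C_F X) ?R"
    show "X closure_of (isolated_points X) = topspace X"
    proof (rule ccontr)
      assume "X closure_of (isolated_points X) \<noteq> topspace X"
      then obtain x where x: "x \<in> topspace X - X closure_of (isolated_points X)"
        using closure_of_subset_topspace[of X] by blast
      obtain f where f: "f \<in> carrier ?R" "f x = 1" "\<And>y. y \<in> X closure_of (isolated_points X) \<Longrightarrow> f y = 0"
        using completely_regular_separation[OF X(1) _ x] by auto
      have f0: "f y = 0" if "y \<in> isolated_points X" for y
        using f(3) that closure_of_subset[OF isolated_points_subset[of X]] by blast
      have "f \<noteq> \<zero>\<^bsub>?R\<^esub>" using f(2) x cont_ring_apply(4)[of x X] by auto
      then have "PIdl\<^bsub>?R\<^esub> f \<noteq> {\<zero>\<^bsub>?R\<^esub>}" using cgenideal_self[OF f(1)] by blast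
      then have "C_F X \<inter> PIdl\<^bsub>?R\<^esub> f \<noteq> {\<zero>\<^bsub>?R\<^esub>}"
        using ess cgenideal_ideal[OF f(1)] by (simp add: essential_ideal_def)
      moreover have "\<zero>\<^bsub>?R\<^esub> \<in> C_F X \<inter> PIdl\<^bsub>?R\<^esub> f" using zero ideal_C_F cgenideal_ideal[OF f(1)] by blast
      ultimately obtain h where h: "h \<in> C_F X" "h \<in> PIdl\<^bsub>?R\<^esub> f" "h \<noteq> \<zero>\<^bsub>?R\<^esub>" by blast
      then have "h \<in> carrier ?R" by (simp add: C_F_iff)
      then obtain y where y: "y \<in> topspace X" "h y \<noteq> 0" using h(3) by (rule cozero_nonempty)
      then have "y \<in> isolated_points X" using C_F_cozero_isolated[OF X(2) h(1)] by blast
      then have "f y = 0" by (rule f0)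
      moreover obtain r where "h = r \<otimes>\<^bsub>?R\<^esub> f" using h(2) by (auto simp: cgenideal_def)
      ultimately show False using y by (simp add: cont_ring_apply)
    qed
  }
  assume dense: "X closure_of (isolated_points X) = topspace X"
  have meets: "C_F X \<inter> J \<noteq> {\<zero>\<^bsub>?R\<^esub>}" if J: "ideal J ?R" "J \<noteq> {\<zero>\<^bsub>?R\<^esub>}" for J
  proof -
    interpret J: ideal J ?R by (rule J)
    obtain j where j: "j \<in> J" "j \<noteq> \<zero>\<^bsub>?R\<^esub>" using J zero by blast
    then have jc: "j \<in> carrier ?R" using J.a_subset by blast
    obtain y where y: "y \<in> topspace X" "j y \<noteq> 0" using jc j(2) by (rule cozero_nonempty)
    then have "y \<in> X closure_of (isolated_points X)" using dense by simp
    then have "\<forall>T. y \<in> T \<and> openin X T \<longrightarrow> (\<exists>x. x \<in> isolated_points X \<and> x \<in> T)"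
      by (simp add: in_closure_of)
    from this[rule_format, of "cozero X j"] obtain x where x: "x \<in> isolated_points X" "x \<in> cozero X j"
      using openin_cozero[OF jc] y by blast
    let ?c = "char_fun X {x}"
    have c: "?c \<in> C_F X" using char_fun_in_C_F[OF X(2), of "{x}"] x by simp
    have "j \<otimes>\<^bsub>?R\<^esub> ?c \<in> C_F X" using c jc ideal.I_l_closed[OF ideal_C_F] by blast
    moreover have "j \<otimes>\<^bsub>?R\<^esub> ?c \<in> J" using c j J.I_r_closed by (auto simp: C_F_iff)
    moreover have "(j \<otimes>\<^bsub>?R\<^esub> ?c) x \<noteq> \<zero>\<^bsub>?R\<^esub> x" using x(2) by (simp add: cont_ring_apply)
    then have "j \<otimes>\<^bsub>?R\<^esub> ?c \<noteq> \<zero>\<^bsub>?R\<^esub>" by metis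
    ultimately show ?thesis by blast
  qed
  moreover have "C_F X \<noteq> {\<zero>\<^bsub>?R\<^esub>}"
  proof -
    obtain x where "x \<in> topspace X" using ne by blast
    then have "\<one>\<^bsub>?R\<^esub> \<noteq> \<zero>\<^bsub>?R\<^esub>" by (metis cont_ring_apply(3,4) zero_neq_one)
    then have "carrier ?R \<noteq> {\<zero>\<^bsub>?R\<^esub>}" using one_closed by blast
    then have "C_F X \<inter> carrier ?R \<noteq> {\<zero>\<^bsub>?R\<^esub>}" using meets oneideal by blast
    then show ?thesis using zero[OF ideal_C_F] by auto
  qed
  ultimately show "essential_ideal (C_F X) ?R" using ideal_C_F by (simp add: essential_ideal_def)
qed

lemma all_Inter_essential_iff_dense:
  assumes X: "completely_regular_space X" "Hausdorff_space X" and ne: "topspace X \<noteq> {}"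
  shows "(\<forall>\<F>. \<F> \<subseteq> essential_minimal_primes (cont_ring X) \<longrightarrow>
            essential_ideal (ideal_Inter (cont_ring X) \<F>) (cont_ring X)) \<longleftrightarrow>
         X closure_of (isolated_points X) = topspace X"
proof -
  let ?R = "cont_ring X"
  interpret cring ?R by (rule cring_cont_ring)
  have "essential_ideal (ideal_Inter ?R \<F>) ?R"
    if ess: "essential_ideal (C_F X) ?R" and \<F>: "\<F> \<subseteq> essential_minimal_primes ?R" for \<F>
  proof (rule essential_ideal_mono[OF ess])
    show "C_F X \<subseteq> ideal_Inter ?R \<F>"
      using \<F> Inter_essential_minimal_primes_eq_C_F[OF X] by (auto simp: ideal_Inter_def)
    show "ideal (ideal_Inter ?R \<F>) ?R"
      using \<F> by (intro ideal_ideal_Inter[OF ring_axioms]) (auto simp: essential_minimal_primes_def essential_ideal_def)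
  qed
  then have "(\<forall>\<F>. \<F> \<subseteq> essential_minimal_primes ?R \<longrightarrow> essential_ideal (ideal_Inter ?R \<F>) ?R)
      \<longleftrightarrow> essential_ideal (C_F X) ?R"
    using Inter_essential_minimal_primes_eq_C_F[OF X] by auto
  then show ?thesis using essential_C_F_iff[OF X ne] by simp
qed

section \<open>Functions with compact support\<close>

lemma cozero_subset_supp: "cozero X f \<subseteq> supp X f"
  unfolding supp_eq by (rule closure_of_subset) auto

lemma supp_C_F:
  assumes "Hausdorff_space X" "f \<in> C_F X"
  shows "supp X f = cozero X f"
  unfolding supp_eq using assms
  by (intro closure_of_closedin closedin_Hausdorff_finite) (auto simp: C_F_iff)

lemma C_F_subset_C_K:
  assumes "Hausdorff_space X"
  shows "C_F X \<subseteq> C_K X"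
  using supp_C_F[OF assms] by (auto simp: C_K_def C_F_iff intro: finite_imp_compactin)

lemma isolated_subset_locally_compact: "isolated_points X \<subseteq> locally_compact_points X"
proof
  fix x assume "x \<in> isolated_points X"
  then show "x \<in> locally_compact_points X"
    unfolding isolated_points_def locally_compact_points_def
    using finite_imp_compactin[of "{x}" X] by blast
qed

lemma isolated_subset_supp_C_K:
  assumes "Hausdorff_space X"
  shows "isolated_points X \<subseteq> (\<Union>f\<in>C_K X. supp X f)"
proof
  fix x assume x: "x \<in> isolated_points X"
  then have "char_fun X {x} \<in> C_K X" using char_fun_in_C_F[OF assms, of "{x}"] C_F_subset_C_K[OF assms] by auto
  moreover have "x \<in> cozero X (char_fun X {x})"
    using x isolated_points_subset[of X] by (auto simp: char_fun_def)
  then have "x \<in> supp X (char_fun X {x})" by (rule subsetD[OF cozero_subset_supp])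
  ultimately show "x \<in> (\<Union>f\<in>C_K X. supp X f)" by blast
qed

text \<open>
  A compact support made of isolated points is covered by the open singletons of its points, so
  it is finite.
\<close>
lemma C_K_subset_C_F:
  assumes "(\<Union>f\<in>C_K X. supp X f) \<subseteq> isolated_points X"
  shows "C_K X \<subseteq> C_F X"
proof
  fix f assume f: "f \<in> C_K X"
  then have cpt: "compactin X (supp X f)" and sub: "supp X f \<subseteq> isolated_points X"
    using assms by (auto simp: C_K_def)
  then obtain \<F> where \<F>: "finite \<F>" "\<F> \<subseteq> (\<lambda>x. {x}) ` supp X f" "supp X f \<subseteq> \<Union>\<F>"
    using compactinD[OF cpt, of "(\<lambda>x. {x}) ` supp X f"] by (force simp: isolated_points_def)
  moreover have "finite (\<Union>\<F>)" using \<F>(1,2) by (intro finite_Union) auto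
  ultimately have "finite (supp X f)" by (simp add: finite_subset)
  then have "finite (cozero X f)" by (rule finite_subset[OF cozero_subset_supp])
  then show "f \<in> C_F X" using f by (simp add: C_K_def C_F_iff)
qed

text \<open>
  At a point with a compact neighbourhood a bump function supported in it belongs to \<open>C_K X\<close>. If
  this function has a finite cozero set, the point is isolated.
\<close>
lemma locally_compact_subset_isolated:
  assumes X: "completely_regular_space X" "Hausdorff_space X" and eq: "C_F X = C_K X"
  shows "locally_compact_points X \<subseteq> isolated_points X"
proof
  fix x assume "x \<in> locally_compact_points X"
  then obtain U K where UK: "openin X U" "compactin X K" "x \<in> U" "U \<subseteq> K" "x \<in> topspace X"
    by (auto simp: locally_compact_points_def)
  obtain f where f: "f \<in> carrier (cont_ring X)" "f x = 1" "\<And>y. y \<in> topspace X - U \<Longrightarrow> f y = 0"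
    using completely_regular_bump[OF X(1) UK(1,3)] by blast
  have "cozero X f \<subseteq> K" using f(3) UK(4) by auto
  moreover have "closedin X K" using compactin_imp_closedin X(2) UK(2) by blast
  ultimately have "supp X f \<subseteq> K" unfolding supp_eq by (rule closure_of_minimal)
  then have "compactin X (supp X f)"
    using UK(2) closed_compactin[of X K] by (simp add: supp_eq)
  then have "f \<in> C_F X" using f(1) eq by (simp add: C_K_def)
  then show "x \<in> isolated_points X" using C_F_cozero_isolated[OF X(2)] f(2) UK(5) by force
qed

lemma pure_C_F:
  assumes H: "Hausdorff_space X"
  shows "pure_ideal (C_F X) (cont_ring X)"
  unfolding pure_ideal_def
proof (intro conjI ballI)
  interpret cring "cont_ring X" by (rule cring_cont_ring)
  show "ideal (C_F X) (cont_ring X)" by (rule ideal_C_F)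
  fix f assume f: "f \<in> C_F X"
  have e: "char_fun X (cozero X f) \<in> C_F X"
    using f C_F_cozero_isolated[OF H f] by (intro char_fun_in_C_F[OF H]) (auto simp: C_F_iff)
  have "f = f \<otimes>\<^bsub>cont_ring X\<^esub> char_fun X (cozero X f)"
    by (rule cont_ring_eqI[of _ X]) (use f e in \<open>auto simp: C_F_iff cont_ring_apply\<close>)
  with e show "\<exists>g\<in>C_F X. f = f \<otimes>\<^bsub>cont_ring X\<^esub> g" by blast
qed

text \<open>
  From \<open>f = f \<otimes> g\<close> it follows that \<open>g\<close> is one on the support of \<open>f\<close>, not just where \<open>f\<close> is nonzero, by
  continuity. So the cozero set of \<open>g\<close> is an open set around the support, and
  it lies in the compact support of \<open>g\<close>.
\<close>
lemma pure_C_K_supp_subset: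
  assumes pure: "pure_ideal (C_K X) (cont_ring X)"
  shows "(\<Union>f\<in>C_K X. supp X f) \<subseteq> locally_compact_points X"
proof
  fix x assume "x \<in> (\<Union>f\<in>C_K X. supp X f)"
  then obtain f where f: "f \<in> C_K X" "x \<in> supp X f" by blast
  then obtain g where g: "g \<in> C_K X" "f = f \<otimes>\<^bsub>cont_ring X\<^esub> g" using pure unfolding pure_ideal_def by blast
  have gc: "g \<in> carrier (cont_ring X)" using g(1) by (simp add: C_K_def)
  have "g y = 1" if "y \<in> cozero X f" for y
  proof -
    have "f y = f y * g y" using fun_cong[OF g(2), of y] that cont_ring_apply(1)[of y X f g] by simp
    then show ?thesis using that by simp
  qed
  then have "cozero X f \<subseteq> {y \<in> topspace X. g y \<in> {1}}" by auto
  moreover have "closedin X {y \<in> topspace X. g y \<in> {1}}"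
    using gc by (intro closedin_continuous_map_preimage) (auto simp: cont_ring_carrier_iff)
  ultimately have "supp X f \<subseteq> {y \<in> topspace X. g y \<in> {1}}" unfolding supp_eq by (rule closure_of_minimal)
  then have "x \<in> cozero X g" using f(2) by auto
  then show "x \<in> locally_compact_points X"
    using openin_cozero[OF gc] cozero_subset_supp[of X g] g(1)
    unfolding locally_compact_points_def C_K_def by blast
qed

lemma C_F_eq_C_K_iff_supp:
  assumes X: "completely_regular_space X" "Hausdorff_space X"
  shows "C_F X = C_K X \<longleftrightarrow>
    isolated_points X = locally_compact_points X \<and> locally_compact_points X = (\<Union>f\<in>C_K X. supp X f)"
proof
  assume eq: "C_F X = C_K X"
  have "supp X f \<subseteq> isolated_points X" if "f \<in> C_K X" for f
    using C_F_cozero_isolated[OF X(2), of f] supp_C_F[OF X(2), of f] that by (simp add: eq)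
  then have "(\<Union>f\<in>C_K X. supp X f) \<subseteq> isolated_points X" by blast
  then have "(\<Union>f\<in>C_K X. supp X f) = isolated_points X"
    using isolated_subset_supp_C_K[OF X(2)] by (rule equalityI)
  moreover have "isolated_points X = locally_compact_points X"
    using isolated_subset_locally_compact locally_compact_subset_isolated[OF X eq] by (rule equalityI)
  ultimately show "isolated_points X = locally_compact_points X \<and> locally_compact_points X = (\<Union>f\<in>C_K X. supp X f)"
    by simp
next
  assume "isolated_points X = locally_compact_points X \<and> locally_compact_points X = (\<Union>f\<in>C_K X. supp X f)"
  then show "C_F X = C_K X"
    using C_K_subset_C_F[of X] C_F_subset_C_K[OF X(2)] by auto
qed

lemma C_F_eq_C_K_iff_pure:
  assumes X: "completely_regular_space X" "Hausdorff_space X"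
  shows "C_F X = C_K X \<longleftrightarrow>
    isolated_points X = locally_compact_points X \<and> pure_ideal (C_K X) (cont_ring X)"
proof
  assume eq: "C_F X = C_K X"
  then show "isolated_points X = locally_compact_points X \<and> pure_ideal (C_K X) (cont_ring X)"
    using C_F_eq_C_K_iff_supp[OF X] pure_C_F[OF X(2)] by simp
next
  assume "isolated_points X = locally_compact_points X \<and> pure_ideal (C_K X) (cont_ring X)"
  then have "(\<Union>f\<in>C_K X. supp X f) \<subseteq> isolated_points X" using pure_C_K_supp_subset by auto
  then show "C_F X = C_K X"
    using C_K_subset_C_F C_F_subset_C_K[OF X(2)] by blast
qed

theorem theorem3p6:
  fixes X :: "'a topology"
  assumes "completely_regular_space X" and "Hausdorff_space X"
  shows
    "(ideal_Inter (cont_ring X) (essential_minimal_primes (cont_ring X)) = C_F X \<and>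
       C_F X = socle (cont_ring X)) \<and>
     (topspace X \<noteq> {} \<longrightarrow>
       ((\<forall>\<F>. \<F> \<subseteq> essential_minimal_primes (cont_ring X) \<longrightarrow>
           essential_ideal (ideal_Inter (cont_ring X) \<F>) (cont_ring X)) \<longleftrightarrow>
        X closure_of (isolated_points X) = topspace X)) \<and>
     (ideal_Inter (cont_ring X) (essential_minimal_primes (cont_ring X)) = C_K X \<longleftrightarrow>
       isolated_points X = locally_compact_points X \<and>
       locally_compact_points X = (\<Union>f\<in>C_K X. supp X f)) \<and>
     (ideal_Inter (cont_ring X) (essential_minimal_primes (cont_ring X)) = C_K X \<longleftrightarrow>
       isolated_points X = locally_compact_points X \<and>
       pure_ideal (C_K X) (cont_ring X))"
  using C_F_eq_socle[OF assms] all_Inter_essential_iff_dense[OF assms]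
    C_F_eq_C_K_iff_supp[OF assms] C_F_eq_C_K_iff_pure[OF assms]
  unfolding Inter_essential_minimal_primes_eq_C_F[OF assms] by blast

end
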